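(* For every $n\in\mathbb{Q}_{>0}$ and every integer $N\ge3$, $$\sum_{\substack{j+k=N\\ j\ge1,\,k\ge2}}\zeta^\mu(j,k;n,n)=\mu(N-1)\,\zeta^\mu(N;n)+\mathcal{D}^\mu(N-1,1;n,\mu;n,n).$$
   Context: Fix $\mu\in\mathbb{C}$ with $\mathrm{Re}(\mu)>0$. For $k_1,\dots,k_r\in\mathbb{N}$ with $k_r\ge2$ and $m_1,\dots,m_r\in\mathbb{Q}_{>0}$, $\zeta^\mu(k_1,\dots,k_r;m_1,\dots,m_r)=\sum_{0\le n_1\le\cdots\le n_r}\frac{\mu^r}{(n_1\mu+m_1)^{k_1}\cdots(n_r\mu+m_r)^{k_r}}$. For $K\in\mathbb{N}$ and parameters $a,b,c$ with positive real part, $\mathcal{D}^\mu(K,1;a,b;a,c)=(c-b)\sum_{0\le q_1\le q_2}\frac{\mu^2}{(q_1\mu+a)^{K}(q_2\mu+b)(q_2\mu+c)}$; here it is used with $(a,b,c)=(n,\mu,n)$, i.e. $\mathcal{D}^\mu(N-1,1;n,\mu;n,n)=(n-\mu)\sum_{0\le q_1\le q_2}\frac{\mu^2}{(q_1\mu+n)^{N-1}(q_2\mu+\mu)(q_2\mu+n)}$. *)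

theory Defs
  imports "HOL-Analysis.Analysis"
begin

text \<open>
  Both series converge absolutely on the intended domain: Re mu > 0, all k_i >= 1 with the last
  one >= 2, all m_i > 0 (resp. K >= 1 and a, b, c of positive real part); there the unconditional
  sum is the usual multiple series. The summation index is a weakly increasing list.
\<close>

definition mu_zeta :: "complex \<Rightarrow> nat list \<Rightarrow> rat list \<Rightarrow> complex" where
  "mu_zeta \<mu> ks ms =
     (\<Sum>\<^sub>\<infinity>ns\<in>{ns :: nat list. length ns = length ks \<and> sorted ns}.
        \<mu> ^ length ks / (\<Prod>i<length ks. (of_nat (ns ! i) * \<mu> + of_rat (ms ! i)) ^ (ks ! i)))"

text \<open>\<open>mu_D \<mu> K a b c\<close> is \<open>D\<^sup>\<mu>(K,1;a,b;a,c)\<close>, with the repeated parameter \<open>a\<close> given once.\<close>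

definition mu_D :: "complex \<Rightarrow> nat \<Rightarrow> complex \<Rightarrow> complex \<Rightarrow> complex \<Rightarrow> complex" where
  "mu_D \<mu> K a b c =
     (c - b) * (\<Sum>\<^sub>\<infinity>(q1, q2)\<in>{(q1 :: nat, q2 :: nat). q1 \<le> q2}.
        \<mu>\<^sup>2 / ((of_nat q1 * \<mu> + a) ^ K * (of_nat q2 * \<mu> + b) * (of_nat q2 * \<mu> + c)))"

end

theory Submission
  imports Defs
begin

text \<open>
  Put \<open>y p = 1/(p\<mu> + n)\<close> and \<open>v e = 1/((e + 1)\<mu>)\<close>, and split the double sums at \<open>p = q\<close>. The diagonal
  contributes \<open>(N - 2) \<mu> \<zeta>(N; n)\<close>. Off the diagonal, with \<open>q = p + e + 1\<close>, the sum over \<open>j + k = N\<close> is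
  geometric and equals \<open>y p ^ (N - 1) (v e - y q) - v e (y q) ^ (N - 1)\<close>. Summing the first part over
  \<open>e\<close> and the second over \<open>p\<close> at fixed \<open>q\<close>, the coefficient of \<open>y p ^ (N - 1)\<close> becomes
  \<open>(\<Sum>e. v e - y (p + e + 1)) - (\<Sum>e<p. v e)\<close>, which telescopes to \<open>y p + (\<Sum>q\<ge>p. v q - y q)\<close>: one
  more copy of \<open>\<mu> \<zeta>(N; n)\<close>, and the \<open>D\<close> series. All the double series involved are dominated by
  \<open>1/((p + 1)(e + 1)(p + e + 1)) \<le> ((p + 1)(e + 1)) powr (-3/2)\<close>, so the rearrangements are legitimate.
\<close>

section \<open>Summation tools for double series\<close>

text \<open>Since \<open>(p + 1)(e + 1)\<close> \<le> \<open>(p + e + 1)^2\<close>, the third factor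
  of the bound gives an extra half power in each variable. What remains is a product of two
  convergent series with exponent 3/2.\<close>

lemma summable_on_product_nat_bound:
  fixes f :: "nat \<times> nat \<Rightarrow> complex"
  assumes "\<And>p e. norm (f (p, e)) \<le> C * (1 / real (Suc p) * (1 / real (Suc e)) * (1 / real (Suc (p + e))))"
    and "C \<ge> 0"
  shows "f summable_on UNIV"
proof -
  define s where "s p = real (Suc p) powr (-3/2)" for p
  have s_eq: "s p = 1 / real (Suc p) * (1 / sqrt (real (Suc p)))" for p
    using powr_add[of "real (Suc p)" "-1" "-1/2"]
    by (simp add: s_def powr_minus powr_half_sqrt field_simps)
  have "summable s"
    using summable_real_powr_iff[of "-3/2"]
      summable_Suc_iff[of "\<lambda>n. real n powr (-3/2)"] by (simp add: s_def[abs_def])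
  moreover have s_nonneg: "s p \<ge> 0" for p
    by (simp add: s_def)
  ultimately have s: "s summable_on UNIV"
    by (simp add: summable_on_UNIV_nonneg_real_iff)
  have "(\<lambda>(p, e). s p * s e) summable_on UNIV \<times> UNIV"
  proof (rule summable_on_SigmaI)
    show "((\<lambda>e. case (p, e) of (p, e) \<Rightarrow> s p * s e) has_sum s p * infsum s UNIV) UNIV" for p
      using s by (auto intro!: has_sum_cmult_right)
    show "(\<lambda>p. s p * infsum s UNIV) summable_on UNIV"
      by (intro summable_on_cmult_left s)
  qed (use s_nonneg in auto)
  hence "(\<lambda>z. C * (case z of (p, e) \<Rightarrow> s p * s e)) summable_on UNIV"
    by (intro summable_on_cmult_right) simp
  hence "(\<lambda>z. norm (f z)) summable_on UNIV"
  proof (rule Infinite_Sum.abs_summable_on_comparison_test')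
    fix z :: "nat \<times> nat"
    obtain p e where z: "z = (p, e)"
      by force
    have "real (Suc p) * real (Suc e) \<le> real (Suc (p + e)) ^ 2"
      by (simp add: power2_eq_square algebra_simps)
    hence "sqrt (real (Suc p)) * sqrt (real (Suc e)) \<le> real (Suc (p + e))"
      by (metis of_nat_0_le_iff real_le_lsqrt real_sqrt_mult)
    hence "1 / real (Suc (p + e)) \<le> 1 / sqrt (real (Suc p)) * (1 / sqrt (real (Suc e)))"
      by (simp add: frac_le)
    hence "1 / real (Suc p) * (1 / real (Suc e)) * (1 / real (Suc (p + e))) \<le>
      1 / real (Suc p) * (1 / real (Suc e)) * (1 / sqrt (real (Suc p)) * (1 / sqrt (real (Suc e))))"
      by (intro mult_left_mono) auto
    also have "\<dots> = s p * s e"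
      by (simp add: s_eq)
    finally have "norm (f (p, e)) \<le> C * (s p * s e)"
      using assms(1)[of p e] assms(2) by (meson mult_left_mono order_trans)
    thus "norm (f z) \<le> C * (case z of (p, e) \<Rightarrow> s p * s e)"
      by (simp add: z)
  qed
  thus ?thesis
    by (simp add: summable_on_iff_abs_summable_on_complex)
qed

lemma infsum_pair:
  fixes f :: "'a \<times> 'b \<Rightarrow> complex"
  assumes "f summable_on UNIV"
  shows "infsum f UNIV = (\<Sum>\<^sub>\<infinity>p. \<Sum>\<^sub>\<infinity>e. f (p, e))"
  using infsum_Sigma_banach[of f UNIV "\<lambda>_. UNIV"] assms by simp

lemma summable_on_pair:
  fixes f :: "'a \<times> 'b \<Rightarrow> complex"
  assumes "f summable_on UNIV"
  shows "(\<lambda>p. \<Sum>\<^sub>\<infinity>e. f (p, e)) summable_on UNIV"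
  using summable_on_Sigma_banach[of "\<lambda>p e. f (p, e)" UNIV "\<lambda>_. UNIV"] assms by simp

lemma summable_on_pair_section:
  fixes f :: "'a \<times> 'b \<Rightarrow> complex"
  assumes "f summable_on UNIV"
  shows "(\<lambda>e. f (p, e)) summable_on UNIV"
  using summable_on_SigmaD1[of "\<lambda>p e. f (p, e)" UNIV "\<lambda>_. UNIV" p] assms by simp

lemma summable_on_inj_comp:
  fixes f :: "'a \<Rightarrow> complex"
  assumes "f summable_on UNIV" "inj h"
  shows "(\<lambda>z. f (h z)) summable_on UNIV"
  using summable_on_subset_banach[OF assms(1), of "range h"] summable_on_reindex[OF assms(2), of f]
  by (simp add: o_def)

text \<open>The second coordinate will be the offset \<open>e = q - p\<close>, so the entry 0 is the
  diagonal \<open>p = q\<close> and the remainder is the strict range \<open>p < q\<close>.\<close>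

lemma infsum_pair_nat_split:
  fixes f :: "'a \<times> nat \<Rightarrow> complex"
  assumes "f summable_on UNIV"
  shows "infsum f UNIV = (\<Sum>\<^sub>\<infinity>p. f (p, 0)) + (\<Sum>\<^sub>\<infinity>z. f (fst z, Suc (snd z)))"
proof -
  let ?g = "\<lambda>p :: 'a. (p, 0 :: nat)" and ?h = "\<lambda>z :: 'a \<times> nat. (fst z, Suc (snd z))"
  have "UNIV = range ?g \<union> range ?h"
  proof (rule UNIV_eq_I)
    fix z :: "'a \<times> nat"
    show "z \<in> range ?g \<union> range ?h"
      by (cases z; cases "snd z") (auto intro: rev_image_eqI[of "(fst z, snd z - 1)"])
  qed
  moreover have "infsum f (range ?g \<union> range ?h) = infsum f (range ?g) + infsum f (range ?h)"
    by (intro infsum_Un_disjoint summable_on_subset_banach[OF assms]) auto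
  moreover have "inj ?g" "inj ?h"
    by (auto simp: inj_def)
  ultimately show ?thesis
    by (simp add: infsum_reindex o_def)
qed

lemma infsum_sum:
  fixes f :: "'i \<Rightarrow> 'a \<Rightarrow> complex"
  assumes "finite I" "\<And>i. i \<in> I \<Longrightarrow> f i summable_on A"
  shows "(\<lambda>z. \<Sum>i\<in>I. f i z) summable_on A \<and> (\<Sum>\<^sub>\<infinity>z\<in>A. \<Sum>i\<in>I. f i z) = (\<Sum>i\<in>I. infsum (f i) A)"
  using assms
  by (induction I rule: finite_induct) (auto simp: infsum_add intro!: summable_on_add)

text \<open>Increasing \<open>p\<close> by one adds the series of
  \<open>z (p + e) - z (p + Suc e)\<close>, which telescopes to \<open>z p\<close> because
  \<open>z\<close> tends to 0.\<close>

lemma sums_diff_shift: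
  fixes z :: "nat \<Rightarrow> complex"
  assumes "z \<longlonglongrightarrow> 0"
  shows "(\<lambda>e. z e - z (p + e)) sums (\<Sum>e<p. z e)"
proof (induction p)
  case (Suc p)
  have "(\<lambda>e. z (p + e)) \<longlonglongrightarrow> 0"
    using LIMSEQ_ignore_initial_segment[OF assms, of p] by (simp add: add.commute)
  from sums_add[OF Suc telescope_sums'[OF this]] show ?case
    by simp
qed auto

section \<open>Reciprocals along an arithmetic progression\<close>

locale arithmetic_progression =
  fixes \<mu> a :: complex
  assumes \<mu>_pos: "Re \<mu> > 0" and a_pos: "Re a > 0"
begin

definition y :: "nat \<Rightarrow> complex" where "y p = inverse (of_nat p * \<mu> + a)"

text \<open>Plays two parts: the factor of the D series with parameter \<mu>, and the reciprocal of
  the gap between two terms of the progression \<open>p + 1\<close> steps apart.\<close>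

definition v :: "nat \<Rightarrow> complex" where "v p = inverse (of_nat p * \<mu> + \<mu>)"

lemma progression_nonzero: "of_nat p * \<mu> + a \<noteq> 0" "of_nat p * \<mu> + \<mu> \<noteq> 0"
proof -
  have "Re (of_nat p * \<mu> + a) > 0" "Re (of_nat p * \<mu> + \<mu>) > 0"
    using \<mu>_pos a_pos by (simp_all add: add_nonneg_pos)
  thus "of_nat p * \<mu> + a \<noteq> 0" "of_nat p * \<mu> + \<mu> \<noteq> 0"
    by (metis less_irrefl zero_complex.simps(1))+
qed

lemma y_nonzero: "y p \<noteq> 0"
  using progression_nonzero by (simp add: y_def)

text \<open>The modulus of the denominator is at least its real part, which is at least
  \<open>c * (p + 1)\<close>.\<close>

lemma norm_inverse_progression:
  assumes "Re b \<ge> c" "Re \<mu> \<ge> c" "c > 0"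
  shows "norm (inverse (of_nat p * \<mu> + b)) \<le> inverse c * (1 / real (Suc p))"
proof -
  have "c * real (Suc p) \<le> Re (of_nat p * \<mu> + b)"
    using assms mult_left_mono[of c "Re \<mu>" "real p"] by (simp add: algebra_simps)
  hence "c * real (Suc p) \<le> norm (of_nat p * \<mu> + b)"
    using complex_Re_le_cmod order_trans by blast
  hence "inverse (norm (of_nat p * \<mu> + b)) \<le> inverse (c * real (Suc p))"
    using assms by (intro le_imp_inverse_le) auto
  thus ?thesis
    by (simp add: norm_inverse divide_inverse mult.commute del: of_nat_Suc)
qed

lemma norm_bounds:
  obtains B where "B > 0" "\<And>p. norm (y p) \<le> B * (1 / real (Suc p))"
    "\<And>p. norm (v p) \<le> B * (1 / real (Suc p))"
proof
  let ?c = "min (Re \<mu>) (Re a)"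
  show "inverse ?c > 0"
    using \<mu>_pos a_pos by simp
  show "norm (y p) \<le> inverse ?c * (1 / real (Suc p))" "norm (v p) \<le> inverse ?c * (1 / real (Suc p))" for p
    unfolding y_def v_def using \<mu>_pos a_pos by (intro norm_inverse_progression; simp)+
qed

text \<open>Surplus factors \<open>1 / (p + 1)\<close> are at most 1, so any exponent can be lowered
  to the 1 or 2 needed in the double bounds.\<close>

lemma norm_y_power_bound:
  assumes "k \<ge> l"
  shows "\<exists>C\<ge>0. \<forall>p. norm (y p ^ k) \<le> C * (1 / real (Suc p)) ^ l"
proof -
  obtain B where B: "B > 0" "\<And>p. norm (y p) \<le> B * (1 / real (Suc p))"
    using norm_bounds by blast
  have "norm (y p ^ k) \<le> B ^ k * (1 / real (Suc p)) ^ l" for p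
  proof -
    have "norm (y p ^ k) \<le> (B * (1 / real (Suc p))) ^ k"
      unfolding norm_power by (intro power_mono B) auto
    also have "\<dots> = B ^ k * (1 / real (Suc p)) ^ k"
      by (rule power_mult_distrib)
    also have "\<dots> \<le> B ^ k * (1 / real (Suc p)) ^ l"
      using B assms by (intro mult_left_mono power_decreasing) auto
    finally show ?thesis .
  qed
  thus ?thesis
    using B(1) by (intro exI[of _ "B ^ k"]) auto
qed

lemma tendsto_zero: "y \<longlonglongrightarrow> 0" "v \<longlonglongrightarrow> 0"
proof -
  obtain B where B: "B > 0" "\<And>p. norm (y p) \<le> B * (1 / real (Suc p))"
    "\<And>p. norm (v p) \<le> B * (1 / real (Suc p))"
    using norm_bounds by blast
  have lim: "(\<lambda>p. B * (1 / real (Suc p))) \<longlonglongrightarrow> 0"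
    using tendsto_mult[OF tendsto_const[of B] LIMSEQ_inverse_real_of_nat]
    by (simp add: inverse_eq_divide)
  show "y \<longlonglongrightarrow> 0" "v \<longlonglongrightarrow> 0"
    by (rule Lim_null_comparison[OF _ lim], use B in simp)+
qed

section \<open>Summability of the double series\<close>

lemma inverse_Suc_add_le:
  "1 / real (Suc (p + e)) \<le> 1 / real (Suc e)"
  "1 / real (Suc (Suc (p + e))) \<le> 1 / real (Suc e)"
  "1 / real (Suc (Suc (p + e))) \<le> 1 / real (Suc p)"
  "1 / real (Suc (Suc (p + e))) \<le> 1 / real (Suc (p + e))"
  by (simp_all add: frac_le)

text \<open>Two factors \<open>1 / (p + e + 1)\<close> come from \<open>k\<close> \<ge> 2; one is
  weakened to \<open>1 / (e + 1)\<close> and the other is kept.\<close>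

lemma summable_zeta_term:
  assumes "j \<ge> 1" "k \<ge> 2"
  shows "(\<lambda>(p, e). y p ^ j * y (p + e) ^ k) summable_on UNIV"
proof -
  obtain C where C: "C \<ge> 0" "\<And>p. norm (y p ^ j) \<le> C * (1 / real (Suc p))"
    using norm_y_power_bound[of 1 j] assms by auto
  obtain D where D: "D \<ge> 0" "\<And>p. norm (y p ^ k) \<le> D * (1 / real (Suc p)) ^ 2"
    using norm_y_power_bound[of 2 k] assms by blast
  show ?thesis
  proof (rule summable_on_product_nat_bound[where C = "C * D"])
    fix p e
    have "norm (y p ^ j * y (p + e) ^ k) \<le> (C * (1 / real (Suc p))) * (D * (1 / real (Suc (p + e))) ^ 2)"
      unfolding norm_mult by (intro mult_mono C D) (use C(1) in auto)
    also have "\<dots> = C * D * (1 / real (Suc p)) * ((1 / real (Suc (p + e))) * (1 / real (Suc (p + e))))"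
      by (simp add: power2_eq_square)
    also have "\<dots> \<le> C * D * (1 / real (Suc p)) * ((1 / real (Suc e)) * (1 / real (Suc (p + e))))"
      using C D by (intro mult_left_mono mult_right_mono inverse_Suc_add_le) auto
    finally show "norm (case (p, e) of (p, e) \<Rightarrow> y p ^ j * y (p + e) ^ k)
      \<le> C * D * (1 / real (Suc p) * (1 / real (Suc e)) * (1 / real (Suc (p + e))))"
      by (simp add: mult.assoc)
  qed (use C D in auto)
qed

lemma summable_harmonic_left:
  assumes "m \<ge> 1"
  shows "(\<lambda>(p, e). v e * (y p ^ m * y (Suc (p + e)))) summable_on UNIV"
proof -
  obtain C where C: "C \<ge> 0" "\<And>p. norm (y p ^ m) \<le> C * (1 / real (Suc p))"
    using norm_y_power_bound[of 1 m] assms by auto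
  obtain B where B: "B > 0" "\<And>p. norm (y p) \<le> B * (1 / real (Suc p))"
    "\<And>p. norm (v p) \<le> B * (1 / real (Suc p))"
    using norm_bounds by blast
  show ?thesis
  proof (rule summable_on_product_nat_bound[where C = "B * (C * B)"])
    fix p e
    have "norm (v e * (y p ^ m * y (Suc (p + e)))) \<le>
        (B * (1 / real (Suc e))) * ((C * (1 / real (Suc p))) * (B * (1 / real (Suc (Suc (p + e))))))"
      unfolding norm_mult by (intro mult_mono B C) (use B(1) C(1) in auto)
    also have "\<dots> \<le> (B * (1 / real (Suc e))) * ((C * (1 / real (Suc p))) * (B * (1 / real (Suc (p + e)))))"
      using B(1) C(1) by (intro mult_left_mono inverse_Suc_add_le) auto
    finally show "norm (case (p, e) of (p, e) \<Rightarrow> v e * (y p ^ m * y (Suc (p + e))))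
      \<le> B * (C * B) * (1 / real (Suc p) * (1 / real (Suc e)) * (1 / real (Suc (p + e))))"
      by (simp add: mult_ac)
  qed (use B C in auto)
qed

text \<open>Here \<open>v e\<close> supplies the decay in \<open>e\<close>. Of two factors
  \<open>1 / (p + e + 2)\<close>, one is weakened to \<open>1 / (p + 1)\<close> and the other to
  \<open>1 / (p + e + 1)\<close>.\<close>

lemma summable_harmonic_right:
  assumes "m \<ge> 1"
  shows "(\<lambda>(p, e). v e * y (Suc (p + e)) ^ Suc m) summable_on UNIV"
proof -
  obtain C where C: "C \<ge> 0" "\<And>p. norm (y p ^ Suc m) \<le> C * (1 / real (Suc p)) ^ 2"
    using norm_y_power_bound[of 2 "Suc m"] assms by (metis Suc_le_mono one_add_one plus_1_eq_Suc)
  obtain B where B: "B > 0" "\<And>p. norm (v p) \<le> B * (1 / real (Suc p))"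
    using norm_bounds by blast
  show ?thesis
  proof (rule summable_on_product_nat_bound[where C = "B * C"])
    fix p e
    have "norm (v e * y (Suc (p + e)) ^ Suc m) \<le>
        (B * (1 / real (Suc e))) * (C * (1 / real (Suc (Suc (p + e)))) ^ 2)"
      unfolding norm_mult[of "v e"] by (intro mult_mono B C) (use B(1) in auto)
    also have "\<dots> = B * (1 / real (Suc e)) * (C * (1 / real (Suc (Suc (p + e))) * (1 / real (Suc (Suc (p + e))))))"
      by (simp add: power2_eq_square)
    also have "\<dots> \<le> B * (1 / real (Suc e)) * (C * (1 / real (Suc p) * (1 / real (Suc (p + e)))))"
      using B(1) C(1) by (intro mult_left_mono mult_mono inverse_Suc_add_le) auto
    finally show "norm (case (p, e) of (p, e) \<Rightarrow> v e * y (Suc (p + e)) ^ Suc m)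
      \<le> B * C * (1 / real (Suc p) * (1 / real (Suc e)) * (1 / real (Suc (p + e))))"
      by (simp add: mult_ac)
  qed (use B C in auto)
qed

text \<open>The difference thus decays quadratically although each term decays only linearly, and
  the constant is the prefactor \<open>c - b\<close> of D at \<open>b = \<mu>\<close>,
  \<open>c = a\<close>.\<close>

lemma v_minus_y: "v q - y q = (a - \<mu>) * (v q * y q)"
  using progression_nonzero[of q] by (simp add: v_def y_def field_simps)

lemma summable_D_term:
  assumes "m \<ge> 1"
  shows "(\<lambda>(p, e). y p ^ m * (v (p + e) - y (p + e))) summable_on UNIV"
proof -
  obtain C where C: "C \<ge> 0" "\<And>p. norm (y p ^ m) \<le> C * (1 / real (Suc p))"
    using norm_y_power_bound[of 1 m] assms by auto
  obtain B where B: "B > 0" "\<And>p. norm (y p) \<le> B * (1 / real (Suc p))"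
    "\<And>p. norm (v p) \<le> B * (1 / real (Suc p))"
    using norm_bounds by blast
  have "(\<lambda>(p, e). y p ^ m * (v (p + e) * y (p + e))) summable_on UNIV"
  proof (rule summable_on_product_nat_bound[where C = "C * (B * B)"])
    fix p e
    have "norm (y p ^ m * (v (p + e) * y (p + e))) \<le>
        (C * (1 / real (Suc p))) * ((B * (1 / real (Suc (p + e)))) * (B * (1 / real (Suc (p + e)))))"
      unfolding norm_mult by (intro mult_mono B C) (use B(1) C(1) in auto)
    also have "\<dots> \<le> (C * (1 / real (Suc p))) * ((B * (1 / real (Suc e))) * (B * (1 / real (Suc (p + e)))))"
      using B(1) C(1) by (intro mult_left_mono mult_right_mono inverse_Suc_add_le) auto
    finally show "norm (case (p, e) of (p, e) \<Rightarrow> y p ^ m * (v (p + e) * y (p + e)))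
      \<le> C * (B * B) * (1 / real (Suc p) * (1 / real (Suc e)) * (1 / real (Suc (p + e))))"
      by (simp add: mult_ac)
  qed (use B C in auto)
  hence "(\<lambda>z. (a - \<mu>) * (case z of (p, e) \<Rightarrow> y p ^ m * (v (p + e) * y (p + e)))) summable_on UNIV"
    by (rule summable_on_cmult_right)
  thus ?thesis
    by (simp add: v_minus_y case_prod_unfold mult_ac)
qed

section \<open>Partial fractions and telescoping\<close>

text \<open>The denominators of \<open>y (Suc (p + e))\<close> and \<open>y p\<close> differ by
  \<open>(e + 1) * \<mu>\<close>, the denominator of \<open>v e\<close>; the parameter
  \<open>a\<close> cancels.\<close>

lemma partial_fraction: "v e * y (Suc (p + e)) = y p * (v e - y (Suc (p + e)))"
proof -
  have "of_nat e * \<mu> + \<mu> = (of_nat (Suc (p + e)) * \<mu> + a) - (of_nat p * \<mu> + a)"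
    by (simp add: algebra_simps)
  thus ?thesis
    using progression_nonzero(1)[of p] progression_nonzero(2)[of e] progression_nonzero(1)[of "Suc (p + e)"]
    unfolding v_def y_def by (simp add: divide_simps)
qed

text \<open>Partial fractions turn \<open>?x * ?z\<close> into \<open>v e * (?x - ?z)\<close>, and
  \<open>?x - ?z\<close> times the homogeneous sum is \<open>?x ^ m - ?z ^ m\<close>. The negative
  term stands on the left so that only sums of summable families occur later.\<close>

lemma geometric_sum:
  "(\<Sum>i<m. y p ^ Suc i * y (Suc (p + e)) ^ Suc (m - i)) + v e * y (Suc (p + e)) ^ Suc m
    = v e * (y p ^ m * y (Suc (p + e)))"
proof -
  let ?x = "y p" and ?z = "y (Suc (p + e))"
  have "(\<Sum>i<m. ?x ^ Suc i * ?z ^ Suc (m - i)) = ?x * ?z * ?z * (\<Sum>i<m. ?z ^ (m - Suc i) * ?x ^ i)"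
    unfolding sum_distrib_left
  proof (intro sum.cong refl)
    fix i assume "i \<in> {..<m}"
    hence "m - i = Suc (m - Suc i)"
      by auto
    thus "?x ^ Suc i * ?z ^ Suc (m - i) = ?x * ?z * ?z * (?z ^ (m - Suc i) * ?x ^ i)"
      by (simp add: mult_ac)
  qed
  also have "?x * ?z = v e * (?x - ?z)"
    using partial_fraction[of e p] by (simp add: algebra_simps)
  also have "v e * (?x - ?z) * ?z * (\<Sum>i<m. ?z ^ (m - Suc i) * ?x ^ i) = v e * ?z * (?x ^ m - ?z ^ m)"
    by (simp add: power_diff_sumr2 mult_ac)
  finally show ?thesis
    by (simp add: algebra_simps)
qed

text \<open>Each row of a summable double series is summable; the nonzero power of
  \<open>y p\<close>, constant along the row, is then cancelled.\<close>

lemma sections_summable: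
  "(\<lambda>e. v e - y (Suc (p + e))) summable_on UNIV"
  "(\<lambda>e. v (p + e) - y (p + e)) summable_on UNIV"
proof -
  have "(\<lambda>e. y p ^ 2 * (v e - y (Suc (p + e)))) summable_on UNIV"
  proof -
    have "y p ^ 2 * (v e - y (Suc (p + e))) = v e * (y p ^ 1 * y (Suc (p + e)))" for e
      using partial_fraction[of e p] by (simp add: power2_eq_square mult_ac)
    thus ?thesis
      using summable_on_pair_section[OF summable_harmonic_left[of 1], of p] by simp
  qed
  thus "(\<lambda>e. v e - y (Suc (p + e))) summable_on UNIV"
    by (simp add: summable_on_cmult_right' y_nonzero)
  have "(\<lambda>e. y p ^ 1 * (v (p + e) - y (p + e))) summable_on UNIV"
    using summable_on_pair_section[OF summable_D_term[of 1], of p] by simp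
  thus "(\<lambda>e. v (p + e) - y (p + e)) summable_on UNIV"
    by (simp add: summable_on_cmult_right' y_nonzero)
qed

text \<open>The summand splits as \<open>(v e - v (p + e)) + (v (p + e) - y (p + e)) + (y (p + e) -
  y (p + Suc e))\<close>; the outer two pieces telescope because \<open>v\<close> and
  \<open>y\<close> tend to 0.\<close>

lemma section_identity:
  "(\<Sum>\<^sub>\<infinity>e. v e - y (Suc (p + e))) = (\<Sum>e<p. v e) + ((\<Sum>\<^sub>\<infinity>e. v (p + e) - y (p + e)) + y p)"
proof -
  have S: "(\<lambda>e. v e - y (Suc (p + e))) sums (\<Sum>\<^sub>\<infinity>e. v e - y (Suc (p + e)))"
    and T: "(\<lambda>e. v (p + e) - y (p + e)) sums (\<Sum>\<^sub>\<infinity>e. v (p + e) - y (p + e))"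
    using sections_summable[of p] by (auto intro!: has_sum_imp_sums has_sum_infsum)
  have "(\<lambda>e. y (p + e)) \<longlonglongrightarrow> 0"
    using LIMSEQ_ignore_initial_segment[OF tendsto_zero(1), of p] by (simp add: add.commute)
  hence "(\<lambda>e. y (p + e) - y (p + Suc e)) sums (y (p + 0) - 0)"
    by (rule telescope_sums')
  from sums_add[OF sums_diff_shift[OF tendsto_zero(2), of p] sums_add[OF T this]]
  have "(\<lambda>e. v e - y (Suc (p + e))) sums ((\<Sum>e<p. v e) + ((\<Sum>\<^sub>\<infinity>e. v (p + e) - y (p + e)) + y p))"
    by simp
  with S show ?thesis
    by (rule sums_unique2)
qed

section \<open>Iterated forms of the double series\<close>

text \<open>Grouping by \<open>q = p + e + 1\<close> leaves only \<open>e < q\<close> for each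
  \<open>q\<close>, so the inner sum becomes finite.\<close>

lemma harmonic_right_eq:
  assumes "m \<ge> 1"
  shows "(\<lambda>q. y q ^ Suc m * (\<Sum>e<q. v e)) summable_on UNIV"
    and "(\<Sum>\<^sub>\<infinity>(p, e). v e * y (Suc (p + e)) ^ Suc m) = (\<Sum>\<^sub>\<infinity>q. y q ^ Suc m * (\<Sum>e<q. v e))"
proof -
  let ?T = "SIGMA q:UNIV. {..<q::nat}"
  let ?w = "\<lambda>q e. v e * y q ^ Suc m"
  have summ: "(\<lambda>(q, e). ?w q e) summable_on ?T"
    \<comment> \<open>The inverse map takes \<open>p = q - Suc e\<close>; the subtraction is exact
      because \<open>e < q\<close> on \<open>?T\<close>.\<close>
    using summable_harmonic_right[OF assms]
    by (subst summable_on_reindex_bij_witness[where T = UNIV and j = "\<lambda>(q, e). (q - Suc e, e)"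
          and i = "\<lambda>(p, e). (Suc (p + e), e)" and h = "\<lambda>(p, e). v e * y (Suc (p + e)) ^ Suc m"]) auto
  have eq: "(\<Sum>\<^sub>\<infinity>e\<in>{..<q}. ?w q e) = y q ^ Suc m * (\<Sum>e<q. v e)" for q
    by (simp add: sum_distrib_right mult.commute del: power_Suc)
  show "(\<lambda>q. y q ^ Suc m * (\<Sum>e<q. v e)) summable_on UNIV"
    using summable_on_Sigma_banach[OF summ] unfolding eq .
  have "(\<Sum>\<^sub>\<infinity>(p, e). v e * y (Suc (p + e)) ^ Suc m) = (\<Sum>\<^sub>\<infinity>(q, e)\<in>?T. ?w q e)"
    by (rule infsum_reindex_bij_witness[where i = "\<lambda>(q, e). (q - Suc e, e)"
          and j = "\<lambda>(p, e). (Suc (p + e), e)"]) auto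
  also have "\<dots> = (\<Sum>\<^sub>\<infinity>q. y q ^ Suc m * (\<Sum>e<q. v e))"
    using infsum_Sigma'_banach[OF summ] unfolding eq by simp
  finally show "(\<Sum>\<^sub>\<infinity>(p, e). v e * y (Suc (p + e)) ^ Suc m) = (\<Sum>\<^sub>\<infinity>q. y q ^ Suc m * (\<Sum>e<q. v e))" .
qed

lemma harmonic_left_eq:
  assumes "m \<ge> 1"
  shows "(\<Sum>\<^sub>\<infinity>(p, e). v e * (y p ^ m * y (Suc (p + e)))) =
    (\<Sum>\<^sub>\<infinity>p. y p ^ Suc m * (\<Sum>\<^sub>\<infinity>e. v e - y (Suc (p + e))))"
proof -
  have eq: "v e * (y p ^ m * y (Suc (p + e))) = y p ^ Suc m * (v e - y (Suc (p + e)))" for p e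
    using arg_cong[OF partial_fraction[of e p], of "\<lambda>t. y p ^ m * t"]
    by (simp only: power_Suc mult_ac)
  show ?thesis
    using infsum_pair[OF summable_harmonic_left[OF assms]]
    by (simp only: eq prod.case infsum_cmult_right')
qed

lemma D_eq:
  shows "(\<lambda>p. y p ^ Suc m * (\<Sum>\<^sub>\<infinity>e. v (p + e) - y (p + e))) summable_on UNIV"
    and "(\<Sum>\<^sub>\<infinity>(p, e). y p ^ Suc m * (v (p + e) - y (p + e))) =
      (\<Sum>\<^sub>\<infinity>p. y p ^ Suc m * (\<Sum>\<^sub>\<infinity>e. v (p + e) - y (p + e)))"
  using infsum_pair[OF summable_D_term[of "Suc m"]] summable_on_pair[OF summable_D_term[of "Suc m"]]
  by (simp_all add: infsum_cmult_right' del: power_Suc)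

text \<open>Read off from the row \<open>p = 0\<close> of the double zeta series after cancelling
  \<open>y 0\<close>.\<close>

lemma summable_y_power: "(\<lambda>p. y p ^ (m + 2)) summable_on UNIV"
proof -
  have "(\<lambda>e. y 0 ^ 1 * y (0 + e) ^ (m + 2)) summable_on UNIV"
    using summable_on_pair_section[OF summable_zeta_term[of 1 "m + 2"], of 0] by simp
  thus ?thesis
    by (simp add: summable_on_cmult_right' y_nonzero)
qed

section \<open>The sum formula and its translation\<close>

text \<open>Here \<open>m\<close> is \<open>N - 2\<close>, and the index \<open>i < m\<close>
  encodes \<open>j = i + 1\<close>, \<open>k = m - i + 1\<close>.\<close>

theorem double_sum_formula:
  assumes "m \<ge> 1"
  shows "(\<Sum>i<m. \<Sum>\<^sub>\<infinity>(p, e). y p ^ Suc i * y (p + e) ^ Suc (m - i)) =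
    of_nat (Suc m) * (\<Sum>\<^sub>\<infinity>p. y p ^ (m + 2)) +
    (\<Sum>\<^sub>\<infinity>(p, e). y p ^ Suc m * (v (p + e) - y (p + e)))"
proof -
  let ?f = "\<lambda>i (p, e). y p ^ Suc i * y (p + e) ^ Suc (m - i)"
  let ?F = "\<lambda>z. \<Sum>i<m. ?f i z"
  let ?F' = "\<lambda>z. ?F (fst z, Suc (snd z))"
  let ?u = "\<lambda>(p, e). v e * (y p ^ m * y (Suc (p + e)))"
  let ?w = "\<lambda>(p, e). v e * y (Suc (p + e)) ^ Suc m"
  let ?Z = "\<Sum>\<^sub>\<infinity>p. y p ^ (m + 2)"
  \<comment> \<open>The bound \<open>i < m\<close> makes the second exponent
    \<open>Suc (m - i)\<close> at least 2.\<close>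
  have "?f i summable_on UNIV" if "i \<in> {..<m}" for i
    by (rule summable_zeta_term) (use that in auto)
  from infsum_sum[of "{..<m}", OF _ this]
  have F: "?F summable_on UNIV" "infsum ?F UNIV = (\<Sum>i<m. infsum (?f i) UNIV)"
    by auto
  have "?F (p, 0) = of_nat m * y p ^ (m + 2)" for p
  proof -
    have "y p ^ Suc i * y p ^ Suc (m - i) = y p ^ (m + 2)" if "i < m" for i
      using that by (simp flip: power_add power_Suc)
    thus ?thesis
      by (simp del: power_Suc)
  qed
  hence diag: "(\<Sum>\<^sub>\<infinity>p. ?F (p, 0)) = of_nat m * ?Z"
    by (simp add: infsum_cmult_right' del: power_Suc)
  have "?F' summable_on UNIV"
    by (rule summable_on_inj_comp[OF F(1)]) (auto simp: inj_def)
  hence "infsum ?F' UNIV + infsum ?w UNIV = (\<Sum>\<^sub>\<infinity>z. ?F' z + ?w z)"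
    by (intro infsum_add[symmetric] summable_harmonic_right assms)
  also have "(\<lambda>z. ?F' z + ?w z) = ?u"
    using geometric_sum[of _ _ m] by (auto simp: fun_eq_iff simp del: power_Suc)
  \<comment> \<open>The finite sums produced by \<open>section_identity\<close> add up to
    \<open>infsum ?w UNIV\<close> again, which then cancels against the term added on the
    left.\<close>
  also have "infsum ?u UNIV = (\<Sum>\<^sub>\<infinity>p. y p ^ Suc m * (\<Sum>e<p. v e) +
      (y p ^ Suc m * (\<Sum>\<^sub>\<infinity>e. v (p + e) - y (p + e)) + y p ^ (m + 2)))"
    unfolding harmonic_left_eq[OF assms] section_identity
    by (simp add: algebra_simps)
  also have "\<dots> = infsum ?w UNIV + (infsum (\<lambda>(p, e). y p ^ Suc m * (v (p + e) - y (p + e))) UNIV + ?Z)"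
    unfolding harmonic_right_eq(2)[OF assms] D_eq(2)
    by (subst infsum_add | intro harmonic_right_eq(1) D_eq(1) summable_y_power summable_on_add assms refl)+
  finally have off: "infsum ?F' UNIV = infsum (\<lambda>(p, e). y p ^ Suc m * (v (p + e) - y (p + e))) UNIV + ?Z"
    by simp
  show ?thesis
    unfolding F(2)[symmetric] infsum_pair_nat_split[OF F(1)] diag off
    by (simp add: algebra_simps)
qed

text \<open>Weakly increasing lists of length two are exactly the lists
  \<open>[p, p + e]\<close>.\<close>

lemma mu_zeta_double_eq:
  assumes "a = of_rat n"
  shows "mu_zeta \<mu> [j, k] [n, n] = \<mu>\<^sup>2 * (\<Sum>\<^sub>\<infinity>(p, e). y p ^ j * y (p + e) ^ k)"
  unfolding mu_zeta_def infsum_cmult_right'[symmetric]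
  by (rule infsum_reindex_bij_witness[where i = "\<lambda>(p, e). [p, p + e]"
        and j = "\<lambda>ns. (ns ! 0, ns ! 1 - ns ! 0)"])
    (auto simp: assms[symmetric] y_def numeral_2_eq_2 length_Suc_conv lessThan_Suc divide_inverse power_inverse)

lemma mu_zeta_single_eq:
  assumes "a = of_rat n"
  shows "mu_zeta \<mu> [k] [n] = \<mu> * (\<Sum>\<^sub>\<infinity>p. y p ^ k)"
  unfolding mu_zeta_def infsum_cmult_right'[symmetric]
  by (rule infsum_reindex_bij_witness[where i = "\<lambda>p. [p]" and j = "\<lambda>ns. ns ! 0"])
    (auto simp: assms[symmetric] y_def length_Suc_conv lessThan_Suc divide_inverse power_inverse)

lemma mu_D_eq:
  "mu_D \<mu> k a \<mu> a = \<mu>\<^sup>2 * (\<Sum>\<^sub>\<infinity>(p, e). y p ^ k * (v (p + e) - y (p + e)))"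
  unfolding mu_D_def v_minus_y infsum_cmult_right'[symmetric]
  by (rule infsum_reindex_bij_witness[where i = "\<lambda>(p, e). (p, p + e)"
        and j = "\<lambda>(p, q). (p, q - p)"])
    (auto simp: y_def v_def divide_inverse power_inverse mult_ac)

end

theorem theorem5p5:
  fixes \<mu> :: complex and n :: rat and N :: nat
  assumes "Re \<mu> > 0" and "n > 0" and "N \<ge> 3"
  shows "(\<Sum>(j, k)\<in>{(j :: nat, k :: nat). j + k = N \<and> j \<ge> 1 \<and> k \<ge> 2}. mu_zeta \<mu> [j, k] [n, n])
         = \<mu> * of_nat (N - 1) * mu_zeta \<mu> [N] [n]
           + mu_D \<mu> (N - 1) (of_rat n) \<mu> (of_rat n)"
proof -
  \<comment> \<open>The embedded rational is real, so positivity of \<open>n\<close> gives the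
    positive real part that the locale requires.\<close>
  have "of_rat n = complex_of_real (of_rat n)"
    by (cases n) (simp add: of_rat_rat)
  hence "Re (of_rat n) = of_rat n"
    by (metis Re_complex_of_real)
  with assms interpret arithmetic_progression \<mu> "of_rat n"
    by unfold_locales auto
  define m where "m = N - 2"
  have m: "N = m + 2" "N - 1 = Suc m" "m \<ge> 1"
    using assms(3) by (auto simp: m_def)
  have "(\<Sum>(j, k)\<in>{(j, k). j + k = N \<and> j \<ge> 1 \<and> k \<ge> 2}. mu_zeta \<mu> [j, k] [n, n]) =
      (\<Sum>i<m. mu_zeta \<mu> [Suc i, Suc (m - i)] [n, n])"
    by (rule sum.reindex_bij_witness[where i = "\<lambda>i. (Suc i, Suc (m - i))" and j = "\<lambda>(j, k). j - 1"])
      (auto simp: m intro!: arg_cong[of _ _ "\<lambda>k. mu_zeta \<mu> [_, k] [n, n]"])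
  also have "\<dots> = \<mu>\<^sup>2 * (\<Sum>i<m. \<Sum>\<^sub>\<infinity>(p, e). y p ^ Suc i * y (p + e) ^ Suc (m - i))"
    by (simp only: mu_zeta_double_eq[OF refl] sum_distrib_left)
  also have "\<dots> = \<mu> * of_nat (N - 1) * mu_zeta \<mu> [N] [n] + mu_D \<mu> (N - 1) (of_rat n) \<mu> (of_rat n)"
    \<comment> \<open>A double series carries \<open>\<mu>\<close> squared but the single zeta only
      one \<mu>; the other is the factor in front of \<open>N - 1\<close>.\<close>
    unfolding double_sum_formula[OF m(3)] mu_zeta_single_eq[OF refl] mu_D_eq m(2)
    unfolding m(1) by (simp add: algebra_simps power2_eq_square)
  finally show ?thesis .
qed

end
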